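(* Let $\lambda=(\lambda_1,\ldots,\lambda_N)$ be a partition, $M=\lambda_1$, and $\alpha=(\alpha_1,\ldots,\alpha_N)\in\mathbb N^N$. Define $\overline n=(\lambda_N,\lambda_{N-1},\ldots,\lambda_1)$ and $\overline d=(\alpha_N,\alpha_{N-1},\ldots,\alpha_1)$. Then the following statements hold. \begin{enumerate} \item The composition $\overline d$ is $\overline n$-admissible if and only if $\alpha\in\operatorname{Comp}(\lambda)$. \item Whenever these equivalent conditions hold, $\mathsf{hbs}_{\overline n}(\overline d)=\alpha^\lambda$. \end{enumerate}
   Context: $\mathbb N=\{0,1,2,\ldots\}$. Definition of $\alpha^\lambda$. For a weak composition $\alpha$, $\alpha^+$ is its weakly decreasing rearrangement and $K(\alpha)$ is the key tableau: the semistandard tableau (English notation) of shape $\alpha^+$ and content $\alpha$ (column $r$ is $\{i:\alpha_i\ge r\}$). Write $\lambda[i]=\lambda_i$. $B_+^\lambda(\alpha)$ is the filling of shape $\alpha^+$ such that, if column $r$ has length $c_r$, its $i$-th entry from the top is $\lambda[\,\cdot\,]$ applied to the $(c_r+1-i)$-th entry from the top of column $r$ of $K(\alpha)$. For a weakly increasing integer column written from bottom to top as $c_1\ge\cdots\ge c_k$, its strictification is the column $d_1>\cdots>d_k$ (bottom to top) with $d_1=c_1$, $d_i=\min\{d_{i-1}-1,c_i\}$. If the columnwise strictification of $B_+^\lambda(\alpha)$ has only positive entries (vacuously true if $\alpha=0$), it is a key tableau and $\alpha^\lambda\in\mathbb N^M$ is the unique weak composition with $K(\alpha^\lambda)=\operatorname{str}(B_+^\lambda(\alpha))$;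 otherwise $\alpha^\lambda$ does not exist. $\operatorname{Comp}(\lambda)=\{\alpha\in\mathbb N^N:\alpha^\lambda\text{ exists}\}$. Admissibility (Feigin–Khoroshkin–Makedonskyi). $\overline d$ is $\overline n$-admissible if $\#\{j\le s:\overline d_j\ne0\}\le\overline n_s$ for every $1\le s\le N$. Half-bubble-sort (Feigin–Khoroshkin–Makedonskyi). For $\overline n$-admissible $\overline d$, start from the empty composition and perform stages $s=1,\ldots,N$. At stage $s$ regard the preceding composition as a composition $\gamma\in\mathbb N^L$, $L=\overline n_s$, by appending trailing zeros. If $\overline d_s=0$, leave $\gamma$ unchanged. If $d=\overline d_s>0$ (admissibility guarantees that $\gamma$ has a zero entry), replace $\gamma$ by the composition $\gamma'\in\mathbb N^L$ determined as follows: there are unique positions $p_0<p_1<\cdots<p_k$ in $\{1,\ldots,L\}$ and values $0=u_{-1}<u_0<\cdots<u_k=d$ with $\gamma_{p_t}=u_{t-1}$ and $u_t=\min(\{d\}\cup\{\gamma_q:p_t<q\le L\})$ for $0\le t\le k$; set $\gamma'_{p_t}=u_t$ for $0\le t\le k$ and leave all other coordinates unchanged. (So $p_0$ is the position of the last zero of $\gamma$, and $p_t$ is the last position holding the value $u_{t-1}$.) The composition in $\mathbb N^M$ obtained after stage $N$ is $\mathsf{hbs}_{\overline n}(\overline d)$. *)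

theory Defs
  imports Main
begin

text \<open>
  Partitions and weak compositions are lists of natural numbers; a partition is a weakly
  decreasing list and may have trailing zeros.  The function \<open>part lam i\<close> is the part
  \<open>\<lambda>\<^sub>i\<close> (so \<open>i\<close> counts from 1), extended by 0 outside the index range; in particular the
  first part of the empty partition is 0.
\<close>

definition part :: "nat list \<Rightarrow> nat \<Rightarrow> nat" where
  "part lam i = (if 1 \<le> i \<and> i \<le> length lam then lam ! (i - 1) else 0)"

text \<open>
  Fillings are given by the list of their columns, from left to right, each column being
  listed from top to bottom.  The entries \<open>i\<close> of a key tableau count from 1.
  The number of columns of the key tableau of \<open>\<alpha>\<close> is the largest part of \<open>\<alpha>\<close>, and column
  \<open>r\<close> has as many entries as \<open>\<alpha>\<close> has parts \<open>\<ge> r\<close>, so the shape is the decreasing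
  rearrangement of \<open>\<alpha>\<close> and the content is \<open>\<alpha>\<close>.
\<close>

definition key_tableau :: "nat list \<Rightarrow> nat list list" where
  "key_tableau alpha =
     map (\<lambda>r. filter (\<lambda>i. part alpha i \<ge> r) [1..<Suc (length alpha)])
       [1..<Suc (Max (insert 0 (set alpha)))]"

definition B_plus :: "nat list \<Rightarrow> nat list \<Rightarrow> int list list" where
  "B_plus lam alpha = map (\<lambda>col. map (\<lambda>i. int (part lam i)) (rev col)) (key_tableau alpha)"

text \<open>
  The argument and the result of \<open>strictify_up\<close> are read from bottom to top: once \<open>d\<close> is
  final, the next entry \<open>c\<close> is replaced by \<open>min (d - 1) c\<close>, which is then final.
\<close>

fun strictify_up :: "int list \<Rightarrow> int list" where
  "strictify_up [] = []"
| "strictify_up [d] = [d]"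
| "strictify_up (d # c # cs) = d # strictify_up (min (d - 1) c # cs)"

definition strictify :: "int list \<Rightarrow> int list" where
  "strictify col = rev (strictify_up (rev col))"

definition str_B_plus :: "nat list \<Rightarrow> nat list \<Rightarrow> int list list" where
  "str_B_plus lam alpha = map strictify (B_plus lam alpha)"

definition comp_pow_exists :: "nat list \<Rightarrow> nat list \<Rightarrow> bool" where
  "comp_pow_exists lam alpha \<longleftrightarrow> (\<forall>col \<in> set (str_B_plus lam alpha). \<forall>x \<in> set col. x > 0)"

text \<open>\<open>\<alpha>\<^sup>\<lambda>\<close>; the value is meaningful only under \<open>comp_pow_exists\<close>.\<close>

definition comp_pow :: "nat list \<Rightarrow> nat list \<Rightarrow> nat list" where
  "comp_pow lam alpha =
     (THE beta. length beta = part lam 1 \<and>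
        map (map int) (key_tableau beta) = str_B_plus lam alpha)"

definition Comp :: "nat list \<Rightarrow> nat list set" where
  "Comp lam = {alpha. length alpha = length lam \<and> comp_pow_exists lam alpha}"

text \<open>In the remaining definitions list positions (and stages) count from 0.\<close>

definition admissible :: "nat list \<Rightarrow> nat list \<Rightarrow> bool" where
  "admissible ns ds \<longleftrightarrow>
     length ds = length ns \<and>
     (\<forall>s < length ns. card {j. j \<le> s \<and> ds ! j \<noteq> 0} \<le> ns ! s)"

text \<open>
  In \<open>hbs_chain d gam ps us\<close> the lists \<open>ps\<close> and \<open>us\<close> hold \<open>p\<^sub>0 < \<dots> < p\<^sub>k\<close> and
  \<open>u\<^sub>0 < \<dots> < u\<^sub>k = d\<close>; thus \<open>(0 # us) ! t\<close> is \<open>u\<close> with index \<open>t - 1\<close>, starting from the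
  value 0 at index \<open>-1\<close>.
\<close>

definition hbs_chain :: "nat \<Rightarrow> nat list \<Rightarrow> nat list \<Rightarrow> nat list \<Rightarrow> bool" where
  "hbs_chain d gam ps us \<longleftrightarrow>
     us \<noteq> [] \<and> length ps = length us \<and>
     sorted_wrt (<) ps \<and> sorted_wrt (<) (0 # us) \<and> last us = d \<and>
     (\<forall>t < length ps.
        ps ! t < length gam \<and>
        gam ! (ps ! t) = (0 # us) ! t \<and>
        us ! t = Min (insert d {gam ! q | q. ps ! t < q \<and> q < length gam}))"

definition hbs_insert :: "nat \<Rightarrow> nat list \<Rightarrow> nat list" where
  "hbs_insert d gam =
     (THE gam'. \<exists>ps us. hbs_chain d gam ps us \<and>
        length gam' = length gam \<and>
        (\<forall>t < length ps. gam' ! (ps ! t) = us ! t) \<and>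
        (\<forall>q < length gam. q \<notin> set ps \<longrightarrow> gam' ! q = gam ! q))"

definition hbs_stage :: "nat \<times> nat \<Rightarrow> nat list \<Rightarrow> nat list" where
  "hbs_stage = (\<lambda>(L, d) gam.
     let gam0 = gam @ replicate (L - length gam) 0
     in if d = 0 then gam0 else hbs_insert d gam0)"

definition hbs :: "nat list \<Rightarrow> nat list \<Rightarrow> nat list" where
  "hbs ns ds = fold hbs_stage (zip ns ds) []"

end

theory Submission
  imports Defs
begin

text \<open>
  Half-bubble-sort and strictification are the same greedy procedure, seen once as an
  operation on compositions and once as an operation on the columns of a key tableau.

  A composition \<open>\<gamma>\<close> is determined by its level sets \<open>{i. \<gamma>\<^sub>i \<ge> r}\<close> for \<open>r \<ge> 1\<close>, and these are the
  columns of its key tableau.  Inserting \<open>d\<close> into \<open>\<gamma>\<close> leaves the levels above \<open>d\<close> alone and adds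
  to each level \<open>r \<le> d\<close> the last position not yet in it: for \<open>u\<^bsub>t-1\<^esub> < r \<le> u\<^sub>t\<close> this position is
  \<open>p\<^sub>t\<close>, since \<open>p\<^sub>t\<close> holds \<open>u\<^bsub>t-1\<^esub>\<close> and all later entries are at least \<open>u\<^sub>t\<close>
  (\<open>level_hbs_insert\<close>).  So level \<open>r\<close> of the half-bubble-sort arises by running through the \<open>i\<close>
  with \<open>\<alpha>\<^sub>i \<ge> r\<close>, from the last one to the first, and adding each time the largest free number
  \<open>\<le> \<lambda>\<^sub>i\<close>.

  On the other side, column \<open>r\<close> of the filling carries the numbers \<open>\<lambda>\<^sub>i\<close> for the same \<open>i\<close>.  Putting
  a further entry \<open>c\<close>, at least as large as the others, at the bottom of a column adds to the
  strictified column the largest integer \<open>\<le> c\<close> that it does not yet contain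
  (\<open>set_strictify_up_Cons\<close>): the run of consecutive numbers starting at \<open>c\<close> is shifted down by one.
  Hence both sides build the same sets (\<open>hbs_level\<close>), as long as the number added is positive.

  That number is positive exactly if fewer than \<open>c\<close> numbers have been placed in \<open>{1..c}\<close>
  (\<open>strictify_up_caps_pos_Cons\<close>).  For the first column, where all nonzero parts of \<open>\<alpha>\<close> are counted,
  this is the admissibility inequality; the other columns have fewer entries and give weaker
  conditions.
\<close>

section \<open>Strictification of a column adds the largest free entry\<close>

text \<open>
  Strictification under an upper bound for the first entry.  Making the bound a parameter is what
  allows induction: removing the first entry changes only the bound.
\<close>

fun strict_below :: "int \<Rightarrow> int list \<Rightarrow> int list" where
  "strict_below b [] = []"
| "strict_below b (c # cs) = min b c # strict_below (min b c - 1) cs"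

lemma strictify_up_Cons: "strictify_up (c # cs) = c # strict_below (c - 1) cs"
  by (induction cs arbitrary: c) simp_all

lemma strictify_up_eq_strict_below:
  assumes "\<And>x. x \<in> set cs \<Longrightarrow> x \<le> b"
  shows "strictify_up cs = strict_below b cs"
  using assms by (cases cs) (simp_all add: strictify_up_Cons min_absorb2)

lemma strict_below_le: "x \<in> set (strict_below b cs) \<Longrightarrow> x \<le> b"
  by (induction cs arbitrary: b) force+

lemma sorted_strict_below: "sorted_wrt (>) (strict_below b cs)"
  by (induction cs arbitrary: b) (auto dest!: strict_below_le)

lemma length_strict_below [simp]: "length (strict_below b cs) = length cs"
  by (induction cs arbitrary: b) simp_all

lemma sorted_strictify_up: "sorted_wrt (>) (strictify_up cs)"
  by (cases cs) (auto simp: strictify_up_Cons sorted_strict_below dest!: strict_below_le)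

lemma length_strictify_up [simp]: "length (strictify_up cs) = length cs"
  by (cases cs) (simp_all add: strictify_up_Cons)

lemma card_strictify_up: "card (set (strictify_up cs)) = length cs"
proof -
  have "distinct (rev (strictify_up cs))"
    using sorted_strictify_up[of cs] strict_sorted_iff[of "rev (strictify_up cs)"]
    by (simp add: sorted_wrt_rev)
  then show ?thesis by (simp add: distinct_card)
qed

text \<open>
  Lowering the bound from \<open>b\<close> to \<open>b - 1\<close> has an effect only if the column starts with \<open>b\<close>; then the
  run \<open>b, b - 1, \<dots>, x + 1\<close> moves down by one step and occupies the free place \<open>x\<close> instead of \<open>b\<close>.
\<close>

lemma insert_strict_below:
  assumes "x \<le> b" and "x \<notin> set (strict_below b cs)"
    and "\<And>y. x < y \<Longrightarrow> y \<le> b \<Longrightarrow> y \<in> set (strict_below b cs)"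
  shows "insert b (set (strict_below (b - 1) cs)) = insert x (set (strict_below b cs))"
  using assms
proof (induction cs arbitrary: b)
  case Nil
  then show ?case by (cases "x = b") force+
next
  case (Cons c cs)
  show ?case
  proof (cases "c < b")
    case True
    then have "b \<notin> set (strict_below b (c # cs))"
      by (auto dest!: strict_below_le)
    then have "x = b"
      using Cons.prems(1) Cons.prems(3)[of b] by fastforce
    then show ?thesis using True by simp
  next
    case False
    then have eq: "strict_below b (c # cs) = b # strict_below (b - 1) cs"
      by simp
    have "insert (b - 1) (set (strict_below (b - 1 - 1) cs)) = insert x (set (strict_below (b - 1) cs))"
    proof (rule Cons.IH)
      show "x \<le> b - 1" using Cons.prems(1,2) eq by auto
      show "x \<notin> set (strict_below (b - 1) cs)" using Cons.prems(2) eq by auto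
      show "y \<in> set (strict_below (b - 1) cs)" if "x < y" "y \<le> b - 1" for y
        using Cons.prems(3)[of y] that eq by auto
    qed
    then show ?thesis using False eq by auto
  qed
qed

text \<open>
  Below the new entry \<open>c\<close> the rest of the column is strictified under the bound \<open>c - 1\<close>, while
  without \<open>c\<close> it is strictified under the bound \<open>c\<close>, which is no restriction.
\<close>

lemma set_strictify_up_Cons:
  assumes le: "\<And>y. y \<in> set cs \<Longrightarrow> y \<le> c"
    and "x \<le> c" and "x \<notin> set (strictify_up cs)"
    and "\<And>y. x < y \<Longrightarrow> y \<le> c \<Longrightarrow> y \<in> set (strictify_up cs)"
  shows "set (strictify_up (c # cs)) = insert x (set (strictify_up cs))"
proof -
  note eq = strictify_up_eq_strict_below[OF le]
  show ?thesis
    using insert_strict_below[of x c cs] assms(2-) by (simp add: eq strictify_up_Cons)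
qed

text \<open>
  The integers are unbounded below, so a free number always exists; its sign is what decides
  whether \<open>\<alpha>\<^sup>\<lambda>\<close> exists.
\<close>

lemma ex_largest_free:
  fixes T :: "int set"
  assumes "finite T"
  obtains x where "x \<le> c" "x \<notin> T" "\<And>y. x < y \<Longrightarrow> y \<le> c \<Longrightarrow> y \<in> T"
proof -
  have "\<exists>x \<le> c. x \<notin> T \<and> (\<forall>y. x < y \<and> y \<le> c \<longrightarrow> y \<in> T)"
    using assms
  proof (induction "card T" arbitrary: T c)
    case 0
    then show ?case by (intro exI[of _ c]) auto
  next
    case (Suc n)
    show ?case
    proof (cases "c \<in> T")
      case True
      then have "n = card (T - {c})" using Suc.hyps Suc.prems by simp
      from Suc.hyps(1)[OF this, of "c - 1"] Suc.prems obtain x where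
        "x \<le> c - 1" "x \<notin> T" "\<forall>y. x < y \<and> y \<le> c - 1 \<longrightarrow> y \<in> T" by auto
      with True show ?thesis by (intro exI[of _ x]) (metis linorder_not_le
          order_le_less zle_diff1_eq)
    qed auto
  qed
  with that show thesis by blast
qed

section \<open>Level sets of compositions\<close>

text \<open>
  Positions count from 1, as do the entries of a key tableau.  Using \<open>part\<close>, which vanishes outside
  the index range, makes levels independent of trailing zeros.
\<close>

definition level :: "nat \<Rightarrow> nat list \<Rightarrow> nat set" where
  "level r gam = {i. r \<le> part gam i}"

lemma level_subset: "0 < r \<Longrightarrow> level r gam \<subseteq> {1..length gam}"
  by (auto simp: level_def part_def split: if_splits)

lemma Suc_in_level: "q < length gam \<Longrightarrow> Suc q \<in> level r gam \<longleftrightarrow> r \<le> gam ! q"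
  by (simp add: level_def part_def)

lemma part_append_zeros: "part (gam @ replicate k 0) i = part gam i"
  by (cases "i - 1 - length gam < k") (auto simp: part_def nth_append)

lemma level_append_zeros: "level r (gam @ replicate k 0) = level r gam"
  by (simp add: level_def part_append_zeros)

lemma level_inject:
  assumes "length beta = length gam" and "\<And>r. 0 < r \<Longrightarrow> level r beta = level r gam"
  shows "beta = gam"
proof (rule nth_equalityI)
  fix q assume "q < length beta"
  then have "r \<le> beta ! q \<longleftrightarrow> r \<le> gam ! q" if "0 < r" for r
    using assms(2)[OF that] Suc_in_level[of q beta r] Suc_in_level[of q gam r] assms(1) by auto
  then show "beta ! q = gam ! q"
    by (metis le_refl le_antisym le_zero_eq neq0_conv)
qed (fact assms(1))

lemma le_Max_level: "0 < r \<Longrightarrow> r \<le> Max (insert 0 (set gam)) \<longleftrightarrow> level r gam \<noteq> {}"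
proof -
  assume "0 < r"
  then have "r \<le> Max (insert 0 (set gam)) \<longleftrightarrow> (\<exists>q < length gam. r \<le> gam ! q)"
    by (auto simp: Max_ge_iff in_set_conv_nth Bex_def)
  also have "\<dots> \<longleftrightarrow> level r gam \<noteq> {}"
  proof
    assume "level r gam \<noteq> {}"
    then obtain i where "i \<in> level r gam" "i \<in> {1..length gam}"
      using level_subset[OF \<open>0 < r\<close>] by blast
    then show "\<exists>q < length gam. r \<le> gam ! q"
      using Suc_in_level[of "i - 1" gam r] by (intro exI[of _ "i - 1"]) auto
  qed (use Suc_in_level in blast)
  finally show ?thesis .
qed

section \<open>One step of the half-bubble-sort adds the last free position to every level\<close>

definition last_free :: "nat \<Rightarrow> nat list \<Rightarrow> nat \<Rightarrow> bool" where
  "last_free r gam m \<longleftrightarrow> 1 \<le> m \<and> m \<le> length gam \<and> m \<notin> level r gam \<and>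
     (\<forall>j. m < j \<and> j \<le> length gam \<longrightarrow> j \<in> level r gam)"

lemma last_free_unique: "last_free r gam m \<Longrightarrow> last_free r gam m' \<Longrightarrow> m = m'"
  unfolding last_free_def by (meson linorder_neqE_nat)

text \<open>
  The property from which \<open>hbs_insert d \<gamma>\<close> is obtained by definite description.
\<close>

definition chain_result :: "nat \<Rightarrow> nat list \<Rightarrow> nat list \<Rightarrow> bool" where
  "chain_result d gam gam' \<longleftrightarrow> (\<exists>ps us. hbs_chain d gam ps us \<and>
        length gam' = length gam \<and>
        (\<forall>t < length ps. gam' ! (ps ! t) = us ! t) \<and>
        (\<forall>q < length gam. q \<notin> set ps \<longrightarrow> gam' ! q = gam ! q))"

text \<open>
  A position \<open>p\<^sub>t\<close> enters level \<open>r\<close> exactly if the jump from \<open>u\<^bsub>t-1\<^esub>\<close> to \<open>u\<^sub>t\<close> crosses \<open>r\<close>.  Any such \<open>p\<^sub>t\<close>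
  is the last free position of level \<open>r\<close>, so there is at most one; for \<open>r \<le> d\<close> there is one because
  the values climb from 0 to \<open>d\<close>.
\<close>

lemma level_chain_result:
  assumes res: "chain_result d gam gam'" and r: "0 < r"
  shows "if r \<le> d then \<exists>m. last_free r gam m \<and> level r gam' = insert m (level r gam)
         else level r gam' = level r gam"
proof -
  from res obtain ps us where ch: "hbs_chain d gam ps us" and len: "length gam' = length gam"
    and on: "\<And>t. t < length ps \<Longrightarrow> gam' ! (ps ! t) = us ! t"
    and off: "\<And>q. q < length gam \<Longrightarrow> q \<notin> set ps \<Longrightarrow> gam' ! q = gam ! q"
    unfolding chain_result_def by blast
  from ch have lps: "length ps = length us" and ne: "us \<noteq> []" and inc: "sorted_wrt (<) (0 # us)"
    and last: "last us = d"
    and pos: "\<And>t. t < length ps \<Longrightarrow> ps ! t < length gam"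
    and val: "\<And>t. t < length ps \<Longrightarrow> gam ! (ps ! t) = (0 # us) ! t"
    and mn: "\<And>t. t < length ps \<Longrightarrow>
      us ! t = Min (insert d {gam ! q | q. ps ! t < q \<and> q < length gam})"
    unfolding hbs_chain_def by auto
  have fin: "finite {gam ! q | q. ps ! t < q \<and> q < length gam}" for t by simp
  have step: "(0 # us) ! t < us ! t" if "t < length ps" for t
    using sorted_wrt_nth_less[OF inc, of t "Suc t"] that lps by simp
  have us_le: "us ! t \<le> d" if "t < length ps" for t
    using mn[OF that] fin by simp
  have later: "us ! t \<le> gam ! q" if "t < length ps" "ps ! t < q" "q < length gam" for t q
    unfolding mn[OF that(1)] using that fin by (intro Min_le) auto
  have cross_free: "last_free r gam (Suc (ps ! t))"
    if t: "t < length ps" and cr: "(0 # us) ! t < r" "r \<le> us ! t" for t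
    unfolding last_free_def
  proof (intro conjI allI impI)
    show "Suc (ps ! t) \<le> length gam" using pos[OF t] by simp
    show "Suc (ps ! t) \<notin> level r gam" using pos[OF t] val[OF t] cr by (simp add: Suc_in_level)
    fix j assume "Suc (ps ! t) < j \<and> j \<le> length gam"
    then obtain q where "j = Suc q" "ps ! t < q" "q < length gam"
      by (cases j) auto
    then show "j \<in> level r gam" using later[OF t, of q] cr by (simp add: Suc_in_level)
  qed simp
  have changed: "r \<le> gam' ! q \<longleftrightarrow> r \<le> gam ! q \<or>
      (\<exists>t < length ps. q = ps ! t \<and> (0 # us) ! t < r \<and> r \<le> us ! t)"
    if q: "q < length gam" for q
  proof (cases "q \<in> set ps")
    case True
    then obtain t where t: "t < length ps" "q = ps ! t" by (auto simp: in_set_conv_nth)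
    show ?thesis
    proof
      assume "r \<le> gam' ! q"
      then show "r \<le> gam ! q \<or> (\<exists>t < length ps. q = ps ! t \<and> (0 # us) ! t < r \<and> r \<le> us ! t)"
        using on[OF t(1)] val[OF t(1)] t by (metis linorder_not_le)
    next
      assume *: "r \<le> gam ! q \<or> (\<exists>t < length ps. q = ps ! t \<and> (0 # us) ! t < r \<and> r \<le> us ! t)"
      show "r \<le> gam' ! q"
      proof (cases "r \<le> gam ! q")
        case True
        then show ?thesis using on[OF t(1)] val[OF t(1)] step[OF t(1)] t(2) by simp
      next
        case False
        with * on show ?thesis by auto
      qed
    qed
  next
    case False
    then show ?thesis using off[OF q] by (metis nth_mem)
  qed
  have mem: "i \<in> level r gam' \<longleftrightarrow> i \<in> level r gam \<or>
      (\<exists>t < length ps. i = Suc (ps ! t) \<and> (0 # us) ! t < r \<and> r \<le> us ! t)" for i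
  proof (cases "i \<in> {1..length gam}")
    case True
    then obtain q where "i = Suc q" "q < length gam" by (cases i) auto
    then show ?thesis using changed[of q] len by (simp add: Suc_in_level)
  next
    case False
    have "Suc (ps ! t) \<in> {1..length gam}" if "t < length ps" for t using pos[OF that] by simp
    with False show ?thesis
      using level_subset[OF r, of gam] level_subset[OF r, of gam'] len by auto
  qed
  show ?thesis
  proof (cases "r \<le> d")
    case True
    \<comment> \<open>The jump that crosses \<open>r\<close> leads to the first chain value that is at least \<open>r\<close>.\<close>
    define t where "t = (LEAST t. r \<le> us ! t)"
    have top: "r \<le> us ! (length us - 1)" using True last ne by (simp add: last_conv_nth)
    have cr: "r \<le> us ! t" unfolding t_def by (rule LeastI, rule top)
    have "t \<le> length us - 1" unfolding t_def by (rule Least_le, rule top)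
    then have t: "t < length ps" using ne lps by (cases us) auto
    have below: "(0 # us) ! t < r"
    proof (cases t)
      case (Suc s)
      then have "\<not> r \<le> us ! s" unfolding t_def by (intro not_less_Least) simp
      then show ?thesis using Suc by simp
    qed (use r in simp)
    note free = cross_free[OF t below cr]
    have "(\<exists>s < length ps. i = Suc (ps ! s) \<and> (0 # us) ! s < r \<and> r \<le> us ! s) \<longleftrightarrow> i = Suc (ps ! t)" for i
    proof
      assume "\<exists>s < length ps. i = Suc (ps ! s) \<and> (0 # us) ! s < r \<and> r \<le> us ! s"
      then obtain s where "s < length ps" "i = Suc (ps ! s)" "(0 # us) ! s < r" "r \<le> us ! s" by blast
      then show "i = Suc (ps ! t)" using last_free_unique[OF free cross_free[of s]] by simp
    qed (use t below cr in blast)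
    then have "level r gam' = insert (Suc (ps ! t)) (level r gam)"
      using mem by blast
    with free True show ?thesis by auto
  next
    case False
    then have "level r gam' = level r gam" using mem us_le by fastforce
    with False show ?thesis by simp
  qed
qed

text \<open>
  The levels of a result are described without reference to the chain, and they determine it.
\<close>

lemma chain_result_unique:
  assumes "chain_result d gam beta" and "chain_result d gam beta'"
  shows "beta = beta'"
proof (rule level_inject)
  show "length beta = length beta'" using assms by (auto simp: chain_result_def)
  fix r :: nat assume "0 < r"
  then show "level r beta = level r beta'"
    using level_chain_result[OF assms(1), of r] level_chain_result[OF assms(2), of r]
      last_free_unique[of r gam] by (auto split: if_splits)
qed

text \<open>
  A chain may start from any value below \<open>d\<close> and all later entries, not only from the last zero;
  this generality is needed because the remainder of a chain starts from \<open>u\<^sub>0\<close>.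
\<close>

lemma ex_chain_from:
  assumes "p < length gam" and "gam ! p < d"
    and "\<And>q. p < q \<Longrightarrow> q < length gam \<Longrightarrow> gam ! p < gam ! q"
    and "u = Min (insert d {gam ! q | q. p < q \<and> q < length gam})"
  shows "\<exists>ps us. length ps = length us \<and> sorted_wrt (<) (p # ps) \<and>
     sorted_wrt (<) (gam ! p # u # us) \<and> last (u # us) = d \<and>
     (\<forall>t < Suc (length ps). (p # ps) ! t < length gam \<and>
        gam ! ((p # ps) ! t) = (gam ! p # u # us) ! t \<and>
        (u # us) ! t = Min (insert d {gam ! q | q. (p # ps) ! t < q \<and> q < length gam}))"
  using assms
proof (induction "length gam - p" arbitrary: p u rule: less_induct)
  case less
  let ?A = "{gam ! q | q. p < q \<and> q < length gam}"
  have fin: "finite ?A" by simp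
  have pu: "gam ! p < u" using less.prems by (auto simp: less.prems(4))
  have "u \<in> insert d ?A" unfolding less.prems(4) using fin by (intro Min_in) auto
  have ud: "u \<le> d" and ule: "\<And>q. p < q \<Longrightarrow> q < length gam \<Longrightarrow> u \<le> gam ! q"
    using fin by (auto simp: less.prems(4) intro!: Min_le)
  show ?case
  proof (cases "u = d")
    case True
    then show ?thesis using less.prems(1,4) pu by (intro exI[of _ "[]"]) simp
  next
    case False
    with \<open>u \<in> insert d ?A\<close> have ex: "\<exists>q. p < q \<and> q < length gam \<and> gam ! q = u" by auto
    \<comment> \<open>The chain continues at the last occurrence of the minimum \<open>u\<close>.\<close>
    define p' where "p' = (GREATEST q. p < q \<and> q < length gam \<and> gam ! q = u)"
    have p': "p < p' \<and> p' < length gam \<and> gam ! p' = u"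
      unfolding p'_def by (rule GreatestI_ex_nat[OF ex, of "length gam"]) simp
    have "gam ! p' < gam ! q" if "p' < q" "q < length gam" for q
    proof -
      have "gam ! q \<noteq> u"
        using Greatest_le_nat[of "\<lambda>q. p < q \<and> q < length gam \<and> gam ! q = u" q "length gam"]
          that p' unfolding p'_def[symmetric] by force
      with ule[of q] that p' show ?thesis by force
    qed
    moreover define u' where "u' = Min (insert d {gam ! q | q. p' < q \<and> q < length gam})"
    moreover have "gam ! p' < d" using p' ud False by simp
    moreover have "length gam - p' < length gam - p" using p' by linarith
    ultimately obtain ps us where IH: "length ps = length us" "sorted_wrt (<) (p' # ps)"
      "sorted_wrt (<) (gam ! p' # u' # us)" "last (u' # us) = d"
      "\<forall>t < Suc (length ps). (p' # ps) ! t < length gam \<and>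
        gam ! ((p' # ps) ! t) = (gam ! p' # u' # us) ! t \<and>
        (u' # us) ! t = Min (insert d {gam ! q | q. (p' # ps) ! t < q \<and> q < length gam})"
      using less.hyps[of p' u'] p' by blast
    show ?thesis
    proof (intro exI conjI)
      show "length (p' # ps) = length (u' # us)" using IH by simp
      show "sorted_wrt (<) (p # p' # ps)" using IH(2) p' by auto
      show "sorted_wrt (<) (gam ! p # u # u' # us)" using IH(3) p' pu by auto
      show "last (u # u' # us) = d" using IH(4) by simp
      show "\<forall>t < Suc (length (p' # ps)). (p # p' # ps) ! t < length gam \<and>
        gam ! ((p # p' # ps) ! t) = (gam ! p # u # u' # us) ! t \<and>
        (u # u' # us) ! t = Min (insert d {gam ! q | q. (p # p' # ps) ! t < q \<and> q < length gam})"
        (is "\<forall>t < _. ?P t")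
      proof (intro allI impI)
        fix t assume "t < Suc (length (p' # ps))"
        then show "?P t"
          using IH(5) p' less.prems(1,4) by (cases t) auto
      qed
    qed
  qed
qed

lemma ex_chain_result:
  assumes "0 < d" and "0 \<in> set gam"
  shows "\<exists>gam'. chain_result d gam gam'"
proof -
  have ex: "\<exists>q. q < length gam \<and> gam ! q = 0" using assms(2) by (auto simp: in_set_conv_nth)
  define p where "p = (GREATEST q. q < length gam \<and> gam ! q = 0)"
  have p: "p < length gam \<and> gam ! p = 0"
    unfolding p_def by (rule GreatestI_ex_nat[OF ex, of "length gam"]) simp
  have after: "gam ! p < gam ! q" if "p < q" "q < length gam" for q
    using Greatest_le_nat[of "\<lambda>q. q < length gam \<and> gam ! q = 0" q "length gam"]
          that p unfolding p_def[symmetric] by force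
  obtain ps us u where ch: "length ps = length us" "sorted_wrt (<) (p # ps)"
     "sorted_wrt (<) (0 # u # us)" "last (u # us) = d"
     "\<forall>t < Suc (length ps). (p # ps) ! t < length gam \<and>
        gam ! ((p # ps) ! t) = (0 # u # us) ! t \<and>
        (u # us) ! t = Min (insert d {gam ! q | q. (p # ps) ! t < q \<and> q < length gam})"
    using ex_chain_from[of p gam d, OF _ _ after refl] p assms(1)
    unfolding conjunct2[OF p] by blast
  have chain: "hbs_chain d gam (p # ps) (u # us)"
    unfolding hbs_chain_def length_Cons
  proof (intro conjI)
    show "Suc (length ps) = Suc (length us)" using ch(1) by simp
  qed (fact ch list.distinct)+
  have dist: "distinct (p # ps)" using ch(2) strict_sorted_iff by blast
  define gam' where "gam' = map (\<lambda>q.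
      case map_of (zip (p # ps) (u # us)) q of None \<Rightarrow> gam ! q | Some v \<Rightarrow> v)
     [0..<length gam]"
  have "map_of (zip (p # ps) (u # us)) ((p # ps) ! t) = Some ((u # us) ! t)" if "t < length (p # ps)" for t
    using map_of_zip_nth[of "p # ps" "u # us" t] ch(1) dist that by simp
  moreover have "map_of (zip (p # ps) (u # us)) q = None" if "q \<notin> set (p # ps)" for q
    using ch(1) that by (simp add: map_of_zip_is_None del: zip_Cons_Cons)
  ultimately have "chain_result d gam gam'"
    unfolding chain_result_def using chain ch(5)
    by (intro exI[of _ "p # ps"] exI[of _ "u # us"])
      (simp add: gam'_def del: zip_Cons_Cons)
  then show ?thesis ..
qed

lemma chain_result_hbs_insert:
  assumes "0 < d" and "0 \<in> set gam"
  shows "chain_result d gam (hbs_insert d gam)"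
proof -
  have "hbs_insert d gam = (THE gam'. chain_result d gam gam')"
    by (simp add: hbs_insert_def chain_result_def)
  then show ?thesis
    using ex_chain_result[OF assms] chain_result_unique by (metis theI)
qed

lemma level_hbs_insert:
  assumes "0 < d" and "0 \<in> set gam" and "0 < r"
  shows "if r \<le> d then \<exists>m. last_free r gam m \<and> level r (hbs_insert d gam) = insert m (level r gam)
         else level r (hbs_insert d gam) = level r gam"
  by (rule level_chain_result[OF chain_result_hbs_insert]) (use assms in auto)

section \<open>Levels of the half-bubble-sort are strictified columns\<close>

text \<open>
  The pairs in \<open>zs\<close> are \<open>(\<lambda>\<^sub>i, \<alpha>\<^sub>i)\<close>; \<open>caps r\<close> is column \<open>r\<close> of the filling \<open>B\<^sub>+\<^sup>\<lambda>(\<alpha>)\<close>, read from bottom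
  to top.  Prepending a pair to \<open>zs\<close> is one stage of the half-bubble-sort.
\<close>

definition caps :: "nat \<Rightarrow> (nat \<times> nat) list \<Rightarrow> int list" where
  "caps r zs = map (int \<circ> fst) (filter (\<lambda>z. r \<le> snd z) zs)"

lemma caps_simps [simp]:
  "caps r [] = []"
  "caps r (z # zs) = (if r \<le> snd z then int (fst z) # caps r zs else caps r zs)"
  by (simp_all add: caps_def)

lemma caps_le: "\<forall>z \<in> set zs. fst z \<le> c \<Longrightarrow> x \<in> set (caps r zs) \<Longrightarrow> x \<le> int c"
  by (auto simp: caps_def)

lemma set_strictify_up_caps_le:
  assumes "\<forall>z \<in> set zs. fst z \<le> c" and "x \<in> set (strictify_up (caps r zs))"
  shows "x \<le> int c"
  using strictify_up_eq_strict_below[of "caps r zs" "int c"] caps_le[OF assms(1)]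
    strict_below_le assms(2) by metis

text \<open>
  If the old column is positive, it is a subset of \<open>{1..c}\<close>.  The number added is the largest
  \<open>x \<le> c\<close> outside this subset, so it is positive exactly if the subset is proper, that is, if the
  old column has fewer than \<open>c\<close> entries.  If no number is added, being a subset of \<open>{1..c}\<close>
  gives the inequality.
\<close>

lemma strictify_up_caps_pos_Cons:
  assumes le: "\<forall>z \<in> set zs. fst z \<le> c"
  shows "(\<forall>x \<in> set (strictify_up (caps r ((c, a) # zs))). 0 < x) \<longleftrightarrow>
    (\<forall>x \<in> set (strictify_up (caps r zs)). 0 < x) \<and> length (caps r ((c, a) # zs)) \<le> c"
proof -
  let ?T = "set (strictify_up (caps r zs))"
  have sub: "?T \<subseteq> {1..int c}" if "\<forall>x \<in> ?T. 0 < x"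
  proof
    fix x assume "x \<in> ?T"
    then have "x \<le> int c" by (rule set_strictify_up_caps_le[OF le])
    moreover have "0 < x" using that \<open>x \<in> ?T\<close> by blast
    ultimately show "x \<in> {1..int c}" by simp
  qed
  show ?thesis
  proof (cases "r \<le> a")
    case False
    have "length (caps r zs) \<le> c" if "\<forall>x \<in> ?T. 0 < x"
      using card_mono[OF _ sub[OF that]] by (simp add: card_strictify_up)
    with False show ?thesis by auto
  next
    case True
    obtain x where x: "x \<le> int c" "x \<notin> ?T" "\<And>y. x < y \<Longrightarrow> y \<le> int c \<Longrightarrow> y \<in> ?T"
      using ex_largest_free[of ?T "int c"] by auto
    have ins: "set (strictify_up (caps r ((c, a) # zs))) = insert x ?T"
      using set_strictify_up_Cons[of "caps r zs" "int c" x] caps_le[OF le] x True by simp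
    have "0 < x \<longleftrightarrow> length (caps r zs) < c" if pos: "\<forall>y \<in> ?T. 0 < y"
    proof
      assume "0 < x"
      then have "?T \<subset> {1..int c}" using sub[OF pos] x by auto
      from psubset_card_mono[OF _ this] show "length (caps r zs) < c"
        by (simp add: card_strictify_up)
    next
      assume less: "length (caps r zs) < c"
      show "0 < x"
      proof (rule ccontr)
        assume "\<not> 0 < x"
        then have "{1..int c} \<subseteq> ?T" using x(3) by auto
        from card_mono[OF _ this] less show False by (simp add: card_strictify_up)
      qed
    qed
    then show ?thesis using ins True by auto
  qed
qed

text \<open>
  Positivity amounts to upper bounds on the lengths of the columns at each stage, and columns
  get shorter as \<open>r\<close> grows.
\<close>

lemma strictify_up_caps_pos_mono:
  assumes "sorted_wrt (\<ge>) (map fst zs)" and "r \<le> r'"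
    and "\<forall>x \<in> set (strictify_up (caps r zs)). 0 < x"
  shows "\<forall>x \<in> set (strictify_up (caps r' zs)). 0 < x"
  using assms(1,3)
proof (induction zs)
  case (Cons z zs)
  obtain c a where z: "z = (c, a)" by fastforce
  have le: "\<forall>z \<in> set zs. fst z \<le> c" using Cons.prems(1) z by auto
  have "length (caps r' (z # zs)) \<le> length (caps r (z # zs))"
  proof -
    have "length (filter (\<lambda>z. r' \<le> snd z) ys) \<le> length (filter (\<lambda>z. r \<le> snd z) ys)" for ys :: "(nat \<times> nat) list"
      using assms(2) by (induction ys) auto
    then show ?thesis unfolding caps_def length_map .
  qed
  then show ?case
    using Cons strictify_up_caps_pos_Cons[OF le, of r a] strictify_up_caps_pos_Cons[OF le, of r' a] z
    by auto
qed simp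

text \<open>
  The stages of the half-bubble-sort process the pairs from the last to the first.  Each one adds
  to every level \<open>r \<le> \<alpha>\<^sub>i\<close> the last free position \<open>\<le> \<lambda>\<^sub>i\<close>, which is the number that prepending \<open>\<lambda>\<^sub>i\<close>
  adds to the strictified column.
\<close>

lemma hbs_level:
  assumes "sorted_wrt (\<ge>) (map fst zs)" and "\<forall>x \<in> set (strictify_up (caps 1 zs)). 0 < x"
  shows "length (foldr hbs_stage zs []) = part (map fst zs) 1 \<and>
    (\<forall>r > 0. int ` level r (foldr hbs_stage zs []) = set (strictify_up (caps r zs)))"
  using assms
proof (induction zs)
  case Nil
  then show ?case by (auto simp: level_def part_def)
next
  case (Cons z zs)
  obtain c a where z: "z = (c, a)" by fastforce
  have le: "\<forall>z \<in> set zs. fst z \<le> c" using Cons.prems(1) z by auto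
  define gam where "gam = foldr hbs_stage zs []"
  define gam0 where "gam0 = gam @ replicate (c - length gam) 0"
  have pos: "\<forall>x \<in> set (strictify_up (caps 1 zs)). 0 < x"
    using Cons.prems(2) strictify_up_caps_pos_Cons[OF le, of 1 a] z by simp
  then have IH: "length gam = part (map fst zs) 1"
    "\<And>r. 0 < r \<Longrightarrow> int ` level r gam = set (strictify_up (caps r zs))"
    using Cons unfolding gam_def by auto
  have "length gam \<le> c" using IH(1) le by (cases zs) (auto simp: part_def)
  then have len0: "length gam0 = c" by (simp add: gam0_def)
  have lev0: "int ` level r gam0 = set (strictify_up (caps r zs))" if "0 < r" for r
    using IH(2)[OF that] level_append_zeros by (simp add: gam0_def)
  have fold: "foldr hbs_stage (z # zs) [] = (if a = 0 then gam0 else hbs_insert a gam0)"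
    by (simp add: hbs_stage_def gam_def gam0_def z)
  show ?case
  proof (cases "a = 0")
    case True
    then show ?thesis using fold len0 lev0 z by (auto simp: part_def)
  next
    case False
    have "length (caps 1 zs) < c"
      using Cons.prems(2) strictify_up_caps_pos_Cons[OF le, of 1 a] z False by simp
    then have "card (level 1 gam0) < card {1..c}"
      using lev0[of 1] card_strictify_up[of "caps 1 zs"] card_image[of int "level 1 gam0"] by simp
    moreover have "level 1 gam0 \<subseteq> {1..c}" using level_subset[of 1 gam0] len0 by simp
    \<comment> \<open>Level 1 does not fill \<open>{1..c}\<close>, so the insertion finds a zero entry.\<close>
    ultimately obtain i where "i \<in> {1..c}" "i \<notin> level 1 gam0"
      by (metis less_irrefl subsetI subset_antisym)
    then obtain q where "q < length gam0" "Suc q \<notin> level 1 gam0"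
      using len0 that[of "i - 1"] by (cases i) auto
    then have "q < length gam0" "gam0 ! q = 0"
      using Suc_in_level[of q gam0 1] by simp_all
    then have zero: "0 \<in> set gam0" by (metis nth_mem)
    have len: "length (hbs_insert a gam0) = c"
      using chain_result_hbs_insert[of a gam0] False zero len0 by (auto simp: chain_result_def)
    have "int ` level r (hbs_insert a gam0) = set (strictify_up (caps r (z # zs)))" if r: "0 < r" for r
    proof (cases "r \<le> a")
      case True
      with level_hbs_insert[of a gam0 r] False zero r obtain m where
        m: "last_free r gam0 m" "level r (hbs_insert a gam0) = insert m (level r gam0)" by auto
      have "set (strictify_up (int c # caps r zs)) = insert (int m) (set (strictify_up (caps r zs)))"
      proof (rule set_strictify_up_Cons)
        show "y \<le> int c" if "y \<in> set (caps r zs)" for y using caps_le[OF le that] .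
        show "int m \<le> int c" using m len0 by (simp add: last_free_def)
        show "int m \<notin> set (strictify_up (caps r zs))"
          using m lev0[OF r, symmetric] by (auto simp: last_free_def)
        show "y \<in> set (strictify_up (caps r zs))" if "int m < y" "y \<le> int c" for y
        proof -
          have "y = int (nat y)" "m < nat y" "nat y \<le> c" using that by auto
          then show ?thesis using m len0 lev0[OF r, symmetric] unfolding last_free_def by blast
        qed
      qed
      then show ?thesis using m True z lev0[OF r] by simp
    next
      case False
      then show ?thesis
        using level_hbs_insert[of a gam0 r] \<open>a \<noteq> 0\<close> zero r lev0[OF r] z by simp
    qed
    then show ?thesis using fold len z False by (simp add: part_def)
  qed
qed

section \<open>Key tableaux and admissibility\<close>

lemma set_key_column:
  "0 < r \<Longrightarrow> set (filter (\<lambda>i. r \<le> part gam i) [1..<Suc (length gam)]) = level r gam"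
  using level_subset[of r gam] by (auto simp: level_def)

lemma length_key_tableau: "length (key_tableau gam) = Max (insert 0 (set gam))"
  by (simp add: key_tableau_def)

lemma nth_key_tableau:
  "k < length (key_tableau gam) \<Longrightarrow>
    key_tableau gam ! k = filter (\<lambda>i. Suc k \<le> part gam i) [1..<Suc (length gam)]"
  by (simp add: key_tableau_def del: upt_Suc)

lemma key_tableau_inject:
  assumes "length beta = length gam" and "key_tableau beta = key_tableau gam"
  shows "beta = gam"
proof (rule level_inject[OF assms(1)])
  fix r :: nat assume r: "0 < r"
  have len: "Max (insert 0 (set beta)) = Max (insert 0 (set gam))"
    using assms(2) length_key_tableau by metis
  show "level r beta = level r gam"
  proof (cases "r \<le> Max (insert 0 (set gam))")
    case True
    then have "r - 1 < length (key_tableau beta)" "r - 1 < length (key_tableau gam)"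
      using r len by (auto simp: length_key_tableau)
    then show ?thesis
      using nth_key_tableau[of "r - 1" beta] nth_key_tableau[of "r - 1" gam] r
        set_key_column[of r beta] set_key_column[of r gam] assms(2) by simp
  next
    case False
    then show ?thesis using le_Max_level[OF r, of gam] le_Max_level[OF r, of beta] len by auto
  qed
qed

lemma map_part_filter_upt:
  assumes "length lam = length alpha"
  shows "map (\<lambda>i. int (part lam i)) (filter (\<lambda>i. r \<le> part alpha i) [1..<Suc (length alpha)])
    = caps r (zip lam alpha)"
proof -
  let ?f = "\<lambda>i. (part lam i, part alpha i)"
  have "zip lam alpha = map ?f [1..<Suc (length alpha)]"
    using assms by (intro nth_equalityI) (simp_all add: part_def del: upt_Suc)
  then have "caps r (zip lam alpha) = map (int \<circ> fst) (filter (\<lambda>z. r \<le> snd z) (map ?f [1..<Suc (length alpha)]))"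
    by (simp add: caps_def del: upt_Suc)
  then show ?thesis by (simp add: filter_map o_def del: upt_Suc)
qed

lemma str_B_plus_caps:
  assumes "length lam = length alpha"
  shows "str_B_plus lam alpha =
    map (\<lambda>r. rev (strictify_up (caps r (zip lam alpha)))) [1..<Suc (Max (insert 0 (set alpha)))]"
  unfolding str_B_plus_def B_plus_def key_tableau_def strictify_def
  by (simp add: rev_map map_part_filter_upt[OF assms] del: upt_Suc One_nat_def)

lemma caps_empty_iff:
  assumes "length lam = length alpha" "0 < r"
  shows "caps r (zip lam alpha) = [] \<longleftrightarrow> level r alpha = {}"
  using map_part_filter_upt[OF assms(1), of r] set_key_column[OF assms(2), of alpha]
  by (metis map_is_Nil_conv set_empty)

lemma comp_pow_exists_iff:
  assumes "length lam = length alpha" and "sorted_wrt (\<ge>) lam"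
  shows "comp_pow_exists lam alpha \<longleftrightarrow> (\<forall>x \<in> set (strictify_up (caps 1 (zip lam alpha))). 0 < x)"
    (is "_ \<longleftrightarrow> ?pos 1")
proof -
  have ex: "comp_pow_exists lam alpha \<longleftrightarrow> (\<forall>r. 0 < r \<and> r \<le> Max (insert 0 (set alpha)) \<longrightarrow> ?pos r)"
    unfolding comp_pow_exists_def str_B_plus_caps[OF assms(1)]
    by (auto simp: less_Suc_eq_le Suc_le_eq simp del: upt_Suc)
  show ?thesis
  proof
    assume "comp_pow_exists lam alpha"
    show "?pos 1"
    proof (cases "1 \<le> Max (insert 0 (set alpha))")
      case False
      then have "caps 1 (zip lam alpha) = []"
        using caps_empty_iff[OF assms(1), of 1] le_Max_level[of 1 alpha] by simp
      then show ?thesis by simp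
    qed (use \<open>comp_pow_exists lam alpha\<close> ex in auto)
  next
    assume "?pos 1"
    then show "comp_pow_exists lam alpha"
      unfolding ex using strictify_up_caps_pos_mono[of "zip lam alpha" 1] assms
      by (metis Suc_leI One_nat_def map_fst_zip)
  qed
qed

text \<open>
  After reversal, the first parts of \<open>\<lambda>\<close> and \<open>\<alpha>\<close> come last and contribute the inequality that counts
  all nonzero parts of \<open>\<alpha>\<close>.
\<close>

lemma admissible_snoc:
  "admissible (ns @ [n]) (ds @ [d]) \<longleftrightarrow>
     admissible ns ds \<and> length (filter (\<lambda>d. d \<noteq> 0) (ds @ [d])) \<le> n"
proof -
  have "card {j. j \<le> s \<and> (ds @ [d]) ! j \<noteq> 0} = card {j. j \<le> s \<and> ds ! j \<noteq> 0}" if "s < length ds" for s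
    using that by (intro arg_cong[where f = card]) (auto simp: nth_append)
  moreover have "card {j. j \<le> length ds \<and> (ds @ [d]) ! j \<noteq> 0} = length (filter (\<lambda>d. d \<noteq> 0) (ds @ [d]))"
    unfolding length_filter_conv_card by (intro arg_cong[where f = card]) auto
  ultimately show ?thesis
    unfolding admissible_def by (auto simp: nth_append_left less_Suc_eq simp del: filter_append)
qed

lemma admissible_iff:
  assumes "length lam = length alpha" and "sorted_wrt (\<ge>) lam"
  shows "admissible (rev lam) (rev alpha) \<longleftrightarrow>
    (\<forall>x \<in> set (strictify_up (caps 1 (zip lam alpha))). 0 < x)"
  using assms
proof (induction lam alpha rule: list_induct2)
  case Nil
  then show ?case by (simp add: admissible_def)
next
  case (Cons c lam a alpha)
  have le: "\<forall>z \<in> set (zip lam alpha). fst z \<le> c"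
    using Cons.prems by (auto dest: set_zip_leftD)
  have "length (filter (\<lambda>d. d \<noteq> 0) alpha) = length (caps 1 (zip lam alpha))"
    using Cons.hyps by (induction lam alpha rule: list_induct2) auto
  then show ?case
    using Cons strictify_up_caps_pos_Cons[OF le, of 1 a]
    by (simp add: admissible_snoc rev_filter[symmetric])
qed

lemma hbs_eq_foldr:
  "length lam = length alpha \<Longrightarrow> hbs (rev lam) (rev alpha) = foldr hbs_stage (zip lam alpha) []"
  by (simp add: hbs_def zip_rev foldr_conv_fold)

text \<open>
  Column \<open>r\<close> on either side is the increasing enumeration of the same set, and the numbers of columns
  agree because level \<open>r\<close> is empty exactly if no part of \<open>\<alpha>\<close> reaches \<open>r\<close>.
\<close>

lemma key_tableau_hbs:
  assumes "length lam = length alpha" and "sorted_wrt (\<ge>) lam" and "comp_pow_exists lam alpha"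
  defines "beta \<equiv> hbs (rev lam) (rev alpha)"
  shows "length beta = part lam 1" and "map (map int) (key_tableau beta) = str_B_plus lam alpha"
proof -
  have lev: "int ` level r beta = set (strictify_up (caps r (zip lam alpha)))" if "0 < r" for r
    using hbs_level[of "zip lam alpha"] assms that
    by (simp add: beta_def hbs_eq_foldr comp_pow_exists_iff)
  show "length beta = part lam 1"
    using hbs_level[of "zip lam alpha"] assms
    by (simp add: beta_def hbs_eq_foldr comp_pow_exists_iff)
  have "level r beta = {} \<longleftrightarrow> level r alpha = {}" if "0 < r" for r
    using lev[OF that] caps_empty_iff[OF assms(1) that]
    by (metis image_is_empty length_0_conv length_strictify_up set_empty)
  then have "r \<le> Max (insert 0 (set beta)) \<longleftrightarrow> r \<le> Max (insert 0 (set alpha))" for r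
    using le_Max_level[of r] by (cases "r = 0") auto
  then have Max: "Max (insert 0 (set beta)) = Max (insert 0 (set alpha))"
    by (meson le_antisym le_refl)
  have "map int (filter (\<lambda>i. r \<le> part beta i) [1..<Suc (length beta)])
      = rev (strictify_up (caps r (zip lam alpha)))" (is "map int ?col = ?str") if "0 < r" for r
  proof -
    have "sorted_wrt (<) ?col" by (intro sorted_wrt_filter) (simp del: upt_Suc)
    then have "sorted_wrt (<) (map int ?col)" by (simp add: sorted_wrt_map)
    moreover have "sorted_wrt (<) ?str"
      using sorted_strictify_up by (simp add: sorted_wrt_rev)
    moreover have "set (map int ?col) = set ?str"
      using lev[OF that] set_key_column[OF that] by (simp del: upt_Suc)
    ultimately show ?thesis by (intro strict_sorted_equal)
  qed
  then show "map (map int) (key_tableau beta) = str_B_plus lam alpha"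
    unfolding str_B_plus_caps[OF assms(1)] key_tableau_def Max by (simp del: upt_Suc)
qed

theorem proposition53:
  fixes N :: nat and lam alpha :: "nat list"
  assumes "length lam = N" and "sorted_wrt (\<ge>) lam" and "length alpha = N"
  shows "(admissible (rev lam) (rev alpha) \<longleftrightarrow> alpha \<in> Comp lam) \<and>
         (alpha \<in> Comp lam \<longrightarrow> hbs (rev lam) (rev alpha) = comp_pow lam alpha)"
proof (intro conjI impI)
  have len: "length lam = length alpha" using assms by simp
  show "admissible (rev lam) (rev alpha) \<longleftrightarrow> alpha \<in> Comp lam"
    using admissible_iff[OF len assms(2)] comp_pow_exists_iff[OF len assms(2)] len
    by (simp add: Comp_def)
  assume "alpha \<in> Comp lam"
  then have "comp_pow_exists lam alpha" by (simp add: Comp_def)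
  note key = key_tableau_hbs[OF len assms(2) this]
  show "hbs (rev lam) (rev alpha) = comp_pow lam alpha"
    unfolding comp_pow_def
  proof (rule the_equality[symmetric])
    fix beta assume beta: "length beta = part lam 1 \<and> map (map int) (key_tableau beta) = str_B_plus lam alpha"
    have "inj (map (map int))" by (intro inj_mapI) simp
    then have "key_tableau beta = key_tableau (hbs (rev lam) (rev alpha))"
      using beta key(2) by (metis injD)
    with beta key(1) show "beta = hbs (rev lam) (rev alpha)" by (intro key_tableau_inject) simp_all
  qed (use key in simp)
qed

end
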